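(* Let $0<c<\log 2$ and $\varepsilon>0$. Then for all sufficiently large positive integers $m$, $$F\left(m,\frac{cm}{\log m}\right)>\exp\left(cm-\frac{c(1+\varepsilon)\, m\log\log m}{\log m}\right).$$
   Context: An addition chain of length $k$ is a sequence of integers $1=a_0<a_1<\cdots<a_k$ such that for each $1\le j\le k$ there are indices $0\le i,s<j$ with $a_j=a_s+a_i$; it leads to $a_k$. For a positive integer $n$, $\ell(n)$ denotes the minimal length of an addition chain leading to $n$. For a positive integer $m$ and a real $r\ge 0$, $F(m,r):=\#\{n\in[2^m,2^{m+1}) : \ell(n)\le m+r\}$. Here $\log$ is the natural logarithm. *)

theory Defs
  imports Complex_Main
begin

text \<open>
  A chain \<open>a\<^sub>0, \<dots>, a\<^sub>k\<close> is a function on \<open>nat\<close> of which only the values at \<open>0, \<dots>, k\<close> matter;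
  since \<open>a\<^sub>0 = 1\<close> is the least entry, natural numbers suffice as values.
\<close>

definition addition_chain :: "nat \<Rightarrow> (nat \<Rightarrow> nat) \<Rightarrow> bool" where
  "addition_chain k a \<longleftrightarrow>
     a 0 = 1 \<and> (\<forall>j<k. a j < a (Suc j)) \<and>
     (\<forall>j. 1 \<le> j \<and> j \<le> k \<longrightarrow> (\<exists>i s. i < j \<and> s < j \<and> a j = a s + a i))"

definition chain_length :: "nat \<Rightarrow> nat" where
  "chain_length n = (LEAST k. \<exists>a. addition_chain k a \<and> a k = n)"

definition chain_count :: "nat \<Rightarrow> real \<Rightarrow> nat" where
  "chain_count m r = card {n. 2 ^ m \<le> n \<and> n < 2 ^ (m + 1) \<and> real (chain_length n) \<le> real m + r}"

text \<open>The minimum in \<^const>\<open>chain_length\<close> is over a nonempty set for every positive integer.\<close>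

lemma addition_chain_exists:
  assumes "n \<ge> 1"
  shows "\<exists>k a. addition_chain k a \<and> a k = n"
proof (intro exI conjI)
  show "addition_chain (n - 1) Suc"
    unfolding addition_chain_def
  proof (intro conjI allI impI)
    fix j assume "1 \<le> j \<and> j \<le> n - 1"
    then show "\<exists>i s. i < j \<and> s < j \<and> Suc j = Suc s + Suc i"
      by (intro exI[of _ 0] exI[of _ "j - 1"]) auto
  qed auto
  show "Suc (n - 1) = n"
    using assms by simp
qed

end

theory Submission
  imports Defs "HOL-Real_Asymp.Real_Asymp"
begin

text \<open>
  Consider the integers whose binary expansion is \<open>1\<close> followed by \<open>k + j\<close> zero digits and \<open>r\<close> odd
  blocks of \<open>k\<close> digits, the first \<open>k\<close> zero digits coming directly after the leading \<open>1\<close>.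
  Reading the digits from the top, such an integer is reached from the initial chain
  \<open>1, 2, \<dots>, 2^k\<close> by \<open>j + kr\<close> doublings and \<open>r\<close> additions, so its chain exceeds
  \<open>m = k + j + kr\<close> by at most \<open>2^k + r\<close>. Since the blocks are odd, the last digit tells whether the
  expansion ends in a zero or in a block, so there are exactly \<open>(j + r choose r) 2^((k-1)r)\<close> of them.
  Take \<open>2^k\<close> of order \<open>m / (log m)^2\<close> and \<open>r\<close> close to \<open>cm / log m\<close>. The blocks then occupy
  at most about \<open>cm / log 2\<close> digits, so \<open>c < log 2\<close> leaves \<open>j\<close> of order \<open>m\<close>. Each block
  contributes \<open>log m - 2 log log m\<close> through its value and \<open>log log m\<close> through its position to the
  logarithm of the count, up to bounded terms.
\<close>

section \<open>The family of integers: size and range\<close>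

text \<open>The recursion removes the lowest piece of the expansion, a free zero digit or an odd
  block \<open>2 * e + 1\<close>. The \<open>k\<close> forced zeros make the starting value
  \<open>2 ^ k\<close>, the last entry of the initial chain, so they cost no further
  doublings.\<close>

fun window_numbers :: "nat \<Rightarrow> nat \<Rightarrow> nat \<Rightarrow> nat set" where
  "window_numbers k j 0 = {2 ^ (k + j)}"
| "window_numbers k 0 (Suc r) =
     (\<lambda>(x, e). 2 ^ k * x + (2 * e + 1)) ` (window_numbers k 0 r \<times> {..<2 ^ (k - 1)})"
| "window_numbers k (Suc j) (Suc r) =
     (*) 2 ` window_numbers k j (Suc r) \<union>
     (\<lambda>(x, e). 2 ^ k * x + (2 * e + 1)) ` (window_numbers k (Suc j) r \<times> {..<2 ^ (k - 1)})"

lemma odd_block_less: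
  fixes e k :: nat
  assumes "k \<ge> 1" "e < 2 ^ (k - 1)"
  shows "2 * e + 1 < 2 ^ k"
  using assms by (cases k) auto

text \<open>An odd block is less than \<open>2 ^ k\<close>, so division by \<open>2 ^ k\<close>
  recovers the prefix and the remainder recovers the block.\<close>

lemma inj_on_append_block:
  fixes k :: nat
  assumes "k \<ge> 1"
  shows "inj_on (\<lambda>(x, e). 2 ^ k * x + (2 * e + 1)) (A \<times> {..<2 ^ (k - 1)} :: (nat \<times> nat) set)"
proof (rule inj_onI, clarify)
  fix x e y f :: nat
  assume e: "e < 2 ^ (k - 1)" and f: "f < 2 ^ (k - 1)"
    and eq: "2 ^ k * x + (2 * e + 1) = 2 ^ k * y + (2 * f + 1)"
  have "x = (2 ^ k * x + (2 * e + 1)) div 2 ^ k" "y = (2 ^ k * y + (2 * f + 1)) div 2 ^ k"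
    using odd_block_less[OF assms e] odd_block_less[OF assms f]
    by (simp_all del: add_Suc_right)
  with eq have "x = y"
    by metis
  with eq show "x = y \<and> e = f"
    by simp
qed

lemma finite_window_numbers: "finite (window_numbers k j r)"
  by (induction k j r rule: window_numbers.induct) auto

text \<open>Parity separates the two ways to end an expansion, so the count obeys Pascal's rule,
  with a factor \<open>2 ^ (k - 1)\<close> per block.\<close>

lemma card_window_numbers:
  assumes "k \<ge> 1"
  shows "card (window_numbers k j r) = ((j + r) choose r) * 2 ^ ((k - 1) * r)"
  using assms
proof (induction k j r rule: window_numbers.induct)
  case (1 k j)
  then show ?case by simp
next
  case (2 k r)
  then have "card (window_numbers k 0 (Suc r)) = card (window_numbers k 0 r) * 2 ^ (k - 1)"
    by (simp only: window_numbers.simps card_image[OF inj_on_append_block] card_cartesian_product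
        card_lessThan)
  also have "\<dots> = 2 ^ ((k - 1) * r) * 2 ^ (k - 1)"
    using 2 by simp
  also have "\<dots> = 2 ^ ((k - 1) * Suc r)"
    by (simp only: power_add[symmetric] mult_Suc_right add.commute)
  finally show ?case
    by simp
next
  case (3 k j r)
  let ?A = "(*) 2 ` window_numbers k j (Suc r)"
  let ?B = "(\<lambda>(x, e). 2 ^ k * x + (2 * e + 1)) ` (window_numbers k (Suc j) r \<times> {..<2 ^ (k - 1)})"
  have "even x" if "x \<in> ?A" for x
    using that by auto
  moreover have "odd x" if "x \<in> ?B" for x
    using that 3(3) by auto
  ultimately have "?A \<inter> ?B = {}"
    by blast
  then have "card (window_numbers k (Suc j) (Suc r)) = card ?A + card ?B"
    by (simp add: card_Un_disjoint finite_window_numbers)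
  also have "card ?A = card (window_numbers k j (Suc r))"
    by (intro card_image inj_onI) simp
  also have "card ?B = card (window_numbers k (Suc j) r) * 2 ^ (k - 1)"
    using 3(3) by (simp only: card_image[OF inj_on_append_block] card_cartesian_product card_lessThan)
  also have "card (window_numbers k (Suc j) r) * 2 ^ (k - 1)
      = ((Suc j + r) choose r) * 2 ^ ((k - 1) * Suc r)"
    by (simp only: 3(2)[OF 3(3)] mult_Suc mult_Suc_right power_add mult_ac)
  also have "card (window_numbers k j (Suc r)) = ((j + Suc r) choose Suc r) * 2 ^ ((k - 1) * Suc r)"
    by (rule 3(1)[OF 3(3)])
  finally show ?case
    by (simp add: add_mult_distrib)
qed

lemma window_numbers_bounds:
  assumes "k \<ge> 1" "x \<in> window_numbers k j r"
  shows "2 ^ (k + j + k * r) \<le> x \<and> x < 2 ^ (k + j + k * r + 1)"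
proof -
  have block: "2 ^ (k + n) \<le> 2 ^ k * y + (2 * e + 1) \<and> 2 ^ k * y + (2 * e + 1) < 2 ^ (k + n + 1)"
    if "e < 2 ^ (k - 1)" "2 ^ n \<le> y" "y < 2 ^ (n + 1)" for y e n :: nat
  proof -
    have "2 ^ k * y + (2 * e + 1) < 2 ^ k * (y + 1)"
      using odd_block_less[OF assms(1) that(1)] by simp
    also have "\<dots> \<le> 2 ^ k * 2 ^ (n + 1)"
      using that(3) by (intro mult_left_mono) auto
    finally have "2 ^ k * y + (2 * e + 1) < 2 ^ (k + n + 1)"
      by (simp add: power_add mult_ac)
    moreover have "(2::nat) ^ (k + n) \<le> 2 ^ k * y"
      using that(2) by (simp add: power_add)
    ultimately show ?thesis
      by linarith
  qed
  \<comment> \<open>The fact \<open>block\<close> mentions the induction variable \<open>k\<close>,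
    so it enters the induction as a premise.\<close>
  show ?thesis
    using assms(2) block
  proof (induction k j r arbitrary: x rule: window_numbers.induct)
    case (1 k j)
    then show ?case by simp
  next
    case (2 k r)
    then obtain y e where x: "x = 2 ^ k * y + (2 * e + 1)" "e < 2 ^ (k - 1)"
      and y: "y \<in> window_numbers k 0 r"
      by auto
    have "2 ^ (k + 0 + k * r) \<le> y \<and> y < 2 ^ (k + 0 + k * r + 1)"
      using 2(1)[OF y 2(3)] .
    from 2(3)[OF x(2) conjunct1[OF this] conjunct2[OF this]] show ?case
      unfolding x by (simp add: ac_simps)
  next
    case (3 k j r)
    from 3(3) consider y where "x = 2 * y" "y \<in> window_numbers k j (Suc r)"
      | y e where "x = 2 ^ k * y + (2 * e + 1)" "e < 2 ^ (k - 1)" "y \<in> window_numbers k (Suc j) r"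
      by auto
    then show ?case
    proof cases
      case 1
      with 3(1)[OF 1(2) 3(4)] show ?thesis
        by simp
    next
      case 2
      have "2 ^ (k + Suc j + k * r) \<le> y \<and> y < 2 ^ (k + Suc j + k * r + 1)"
        using 3(2)[OF 2(3) 3(4)] .
      from 3(4)[OF 2(2) conjunct1[OF this] conjunct2[OF this]] show ?thesis
        unfolding 2(1) by (simp add: ac_simps)
    qed
  qed
qed

section \<open>Addition chains for the family\<close>

text \<open>The chain starts with \<open>1, \<dots>, N\<close>, so that all these numbers may be added at every later step.\<close>

definition reachable :: "nat \<Rightarrow> nat \<Rightarrow> nat \<Rightarrow> bool" where
  "reachable N l x \<longleftrightarrow> (\<exists>a. addition_chain l a \<and> a l = x \<and> N \<le> l + 1 \<and> (\<forall>i<N. a i = i + 1))"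

lemma reachable_initial:
  assumes "N \<ge> 1"
  shows "reachable N (N - 1) N"
proof -
  have "addition_chain (N - 1) Suc"
    unfolding addition_chain_def
  proof (intro conjI allI impI)
    fix j assume "1 \<le> j \<and> j \<le> N - 1"
    then show "\<exists>i s. i < j \<and> s < j \<and> Suc j = Suc s + Suc i"
      by (intro exI[of _ 0] exI[of _ "j - 1"]) auto
  qed auto
  then show ?thesis
    unfolding reachable_def using assms by (intro exI[of _ Suc]) auto
qed

lemma addition_chain_extend:
  assumes a: "addition_chain l a" and "i \<le> l" "s \<le> l" "a l < a s + a i"
  shows "addition_chain (Suc l) (a(Suc l := a s + a i))"
  unfolding addition_chain_def
proof (intro conjI allI impI)
  show "(a(Suc l := a s + a i)) 0 = 1"
    using a by (simp add: addition_chain_def)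
next
  fix j assume "j < Suc l"
  then show "(a(Suc l := a s + a i)) j < (a(Suc l := a s + a i)) (Suc j)"
    using assms by (cases "j = l") (auto simp: addition_chain_def)
next
  fix j assume j: "1 \<le> j \<and> j \<le> Suc l"
  show "\<exists>i' s'. i' < j \<and> s' < j \<and>
          (a(Suc l := a s + a i)) j = (a(Suc l := a s + a i)) s' + (a(Suc l := a s + a i)) i'"
  proof (cases "j = Suc l")
    case True
    then show ?thesis
      using assms by (intro exI[of _ i] exI[of _ s]) auto
  next
    case False
    with j a obtain i' s' where "i' < j" "s' < j" "a j = a s' + a i'"
      unfolding addition_chain_def by (metis le_SucE)
    then show ?thesis
      using j False by (intro exI[of _ i'] exI[of _ s']) auto
  qed
qed

lemma reachable_double:
  assumes "reachable N l x" "x > 0"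
  shows "reachable N (l + 1) (2 * x)"
proof -
  from assms obtain a where a: "addition_chain l a" "a l = x" "N \<le> l + 1" "\<forall>i<N. a i = i + 1"
    unfolding reachable_def by blast
  then have "addition_chain (Suc l) (a(Suc l := a l + a l))"
    using assms(2) by (intro addition_chain_extend) auto
  then show ?thesis
    unfolding reachable_def using a by (intro exI[of _ "a(Suc l := a l + a l)"]) auto
qed

lemma reachable_power2_mult:
  assumes "reachable N l x" "x > 0"
  shows "reachable N (l + k) (2 ^ k * x)"
proof (induction k)
  case 0
  then show ?case using assms by simp
next
  case (Suc k)
  from reachable_double[OF this] show ?case
    using assms by (simp add: mult_ac)
qed

lemma reachable_add:
  assumes "reachable N l x" "0 < d" "d \<le> N"
  shows "reachable N (l + 1) (x + d)"
proof -
  from assms obtain a where a: "addition_chain l a" "a l = x" "N \<le> l + 1" "\<forall>i<N. a i = i + 1"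
    unfolding reachable_def by blast
  \<comment> \<open>Indices start at 0, so the entry \<open>d\<close> has index
    \<open>d - 1\<close>, which is at most \<open>l\<close> because
    \<open>N \<le> l + 1\<close>.\<close>
  have d: "a (d - 1) = d"
    using a(4) assms(2,3) by simp
  have "addition_chain (Suc l) (a(Suc l := a l + a (d - 1)))"
    using a d assms(2,3) by (intro addition_chain_extend) auto
  then show ?thesis
    unfolding reachable_def using a d
    by (intro exI[of _ "a(Suc l := a l + a (d - 1))"]) auto
qed

text \<open>The initial chain takes \<open>2 ^ k - 1\<close> steps to reach \<open>2 ^ k\<close>;
  each free zero costs one doubling, each block \<open>k\<close> doublings and one addition of a
  number below \<open>2 ^ k\<close>.\<close>

lemma reachable_window_numbers:
  assumes "k \<ge> 1" "x \<in> window_numbers k j r"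
  shows "reachable (2 ^ k) (2 ^ k - 1 + j + (k + 1) * r) x"
  using assms
proof (induction k j r arbitrary: x rule: window_numbers.induct)
  case (1 k j)
  have "reachable (2 ^ k) (2 ^ k - 1 + j) (2 ^ j * 2 ^ k)"
    by (intro reachable_power2_mult reachable_initial) simp_all
  with 1 show ?case
    by (simp add: power_add mult_ac)
next
  case (2 k r)
  then obtain y e where x: "x = 2 ^ k * y + (2 * e + 1)" "e < 2 ^ (k - 1)"
    and y: "y \<in> window_numbers k 0 r"
    by auto
  \<comment> \<open>Positivity makes each doubling a strict increase, as a chain requires.\<close>
  have "y > 0"
    using window_numbers_bounds[OF 2(2) y] by (intro gr0I) auto
  then have "reachable (2 ^ k) (2 ^ k - 1 + 0 + (k + 1) * r + k + 1) x"
    unfolding x using odd_block_less[OF 2(2) x(2)]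
    by (intro reachable_add reachable_power2_mult 2(1)[OF 2(2) y]) auto
  moreover have "2 ^ k - 1 + 0 + (k + 1) * r + k + 1 = 2 ^ k - 1 + 0 + (k + 1) * Suc r"
    by simp
  ultimately show ?case
    by (simp only:)
next
  case (3 k j r)
  from 3(4) consider y where "x = 2 * y" "y \<in> window_numbers k j (Suc r)"
    | y e where "x = 2 ^ k * y + (2 * e + 1)" "e < 2 ^ (k - 1)" "y \<in> window_numbers k (Suc j) r"
    by auto
  then show ?case
  proof cases
    case 1
    have "y > 0"
      using window_numbers_bounds[OF 3(3) 1(2)] by (intro gr0I) auto
    then have "reachable (2 ^ k) (2 ^ k - 1 + j + (k + 1) * Suc r + 1) x"
      unfolding 1(1) by (intro reachable_double 3(1)[OF 3(3) 1(2)])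
    moreover have "2 ^ k - 1 + j + (k + 1) * Suc r + 1 = 2 ^ k - 1 + Suc j + (k + 1) * Suc r"
      by simp
    ultimately show ?thesis
      by (simp only:)
  next
    case 2
    have "y > 0"
      using window_numbers_bounds[OF 3(3) 2(3)] by (intro gr0I) auto
    then have "reachable (2 ^ k) (2 ^ k - 1 + Suc j + (k + 1) * r + k + 1) x"
      unfolding 2(1) using odd_block_less[OF 3(3) 2(2)]
      by (intro reachable_add reachable_power2_mult 3(2)[OF 3(3) 2(3)]) auto
    moreover have "2 ^ k - 1 + Suc j + (k + 1) * r + k + 1 = 2 ^ k - 1 + Suc j + (k + 1) * Suc r"
      by simp
    ultimately show ?thesis
      by (simp only:)
  qed
qed

lemma chain_length_le_reachable:
  assumes "reachable N l x"
  shows "chain_length x \<le> l"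
  using assms unfolding reachable_def chain_length_def by (blast intro: Least_le)

section \<open>Lower bounds for the counting function\<close>

lemma chain_count_ge:
  assumes k: "k \<ge> 1" and m: "m = k + j + k * r" and R: "2 ^ k + real r \<le> R"
  shows "((j + r) choose r) * 2 ^ ((k - 1) * r) \<le> chain_count m R"
proof -
  have "window_numbers k j r
      \<subseteq> {n. 2 ^ m \<le> n \<and> n < 2 ^ (m + 1) \<and> real (chain_length n) \<le> real m + R}"
  proof
    fix n assume n: "n \<in> window_numbers k j r"
    have "chain_length n \<le> 2 ^ k - 1 + j + (k + 1) * r"
      using chain_length_le_reachable[OF reachable_window_numbers[OF k n]] .
    also have "\<dots> \<le> m + (2 ^ k + r)"
      by (simp add: m)
    finally have "real (chain_length n) \<le> real (m + (2 ^ k + r))"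
      by (rule of_nat_mono)
    with R window_numbers_bounds[OF k n]
    show "n \<in> {n. 2 ^ m \<le> n \<and> n < 2 ^ (m + 1) \<and> real (chain_length n) \<le> real m + R}"
      by (simp add: m)
  qed
  moreover have "finite {n. 2 ^ m \<le> n \<and> n < 2 ^ (m + 1) \<and> real (chain_length n) \<le> real m + R}"
    by (rule finite_subset[of _ "{..<2 ^ (m + 1)}"]) auto
  ultimately have "card (window_numbers k j r) \<le> chain_count m R"
    unfolding chain_count_def by (intro card_mono)
  then show ?thesis
    by (simp add: card_window_numbers[OF k])
qed

text \<open>Per block, \<open>\<beta>\<close> bounds from below the contribution of the positions
  and \<open>\<gamma>\<close> the number of odd values, via
  \<open>((j + r) choose r) \<ge> ((j + r) / r) ^ r\<close>.\<close>

lemma chain_count_ge_exp: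
  assumes k: "k \<ge> 1" and r: "r \<ge> 1" and m: "m = k + j + k * r" and R: "2 ^ k + real r \<le> R"
    and j: "\<beta> \<le> real j / real r" and \<gamma>: "2 * \<gamma> \<le> 2 ^ k" and pos: "\<beta> > 0" "\<gamma> > 0"
  shows "exp (real r * (ln \<beta> + ln \<gamma>)) \<le> real (chain_count m R)"
proof -
  have "exp (real r * (ln \<beta> + ln \<gamma>)) = \<beta> ^ r * \<gamma> ^ r"
    using pos by (simp add: distrib_left exp_add exp_of_nat_mult)
  also have "\<dots> \<le> real ((j + r) choose r) * (2 ^ (k - 1)) ^ r"
  proof (intro mult_mono power_mono)
    have "\<beta> ^ r \<le> (real (j + r) / real r) ^ r"
      using j pos by (intro power_mono order.trans[OF j] divide_right_mono) auto
    also have "\<dots> \<le> real ((j + r) choose r)"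
      by (intro binomial_ge_n_over_k_pow_k) simp
    finally show "\<beta> ^ r \<le> real ((j + r) choose r)" .
    show "\<gamma> \<le> 2 ^ (k - 1)"
      using \<gamma> k by (cases k) auto
  qed (use pos in auto)
  also have "\<dots> = real (((j + r) choose r) * 2 ^ ((k - 1) * r))"
    by (simp add: power_mult)
  also have "\<dots> \<le> real (chain_count m R)"
    using chain_count_ge[OF k m R] by (rule of_nat_mono)
  finally show ?thesis .
qed

section \<open>Choice of parameters and asymptotics\<close>

theorem theorem2:
  fixes c \<epsilon> :: real
  assumes "0 < c" and "c < ln 2" and "\<epsilon> > 0"
  shows "\<forall>\<^sub>F m :: nat in sequentially.
    real (chain_count m (c * real m / ln (real m)))
      > exp (c * real m - c * (1 + \<epsilon>) * real m * ln (ln (real m)) / ln (real m))"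
proof -
  \<comment> \<open>The blocks occupy at most a fraction \<open>c / ln 2 = 1 - 2 * \<delta>\<close>
    of the digits. One \<open>\<delta> * m\<close> absorbs the \<open>k\<close> forced zeros, the
    other remains for \<open>j\<close>.\<close>
  define \<delta> where "\<delta> = (1 - c / ln 2) / 2"
  have "\<delta> > 0"
    using assms by (simp add: \<delta>_def)
  define D where "D = \<delta> / c"
  have "D > 0"
    using \<open>\<delta> > 0\<close> assms by (simp add: D_def)
  define K where "K = ln D - ln 4"

  have "\<forall>\<^sub>F m :: nat in sequentially. real m > 1 \<and> ln (real m) > 1"
    by (intro eventually_conj; real_asymp)
  moreover have "\<forall>\<^sub>F m :: nat in sequentially. real m / ln (real m) ^ 2 \<ge> 2"
    by real_asymp
  moreover have "\<forall>\<^sub>F m :: nat in sequentially. c * real m / ln (real m) - real m / ln (real m) ^ 2 \<ge> 1"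
    using assms(1) by real_asymp
  moreover have "\<forall>\<^sub>F m :: nat in sequentially. ln (real m) / ln 2 \<le> \<delta> * real m"
    using \<open>\<delta> > 0\<close> by real_asymp
  moreover have "\<forall>\<^sub>F m :: nat in sequentially. ln (real m) - ln (ln (real m)) + K > 0"
    by real_asymp
  \<comment> \<open>With \<open>L = ln m\<close>, the product is
    \<open>c * m - c * m * ln L / L\<close> up to an error of order \<open>m / L\<close>, which the
    extra \<open>\<epsilon>\<close> term absorbs.\<close>
  moreover have "\<forall>\<^sub>F m :: nat in sequentially.
      c * real m - c * (1 + \<epsilon>) * real m * ln (ln (real m)) / ln (real m)
        < (c * real m / ln (real m) - real m / ln (real m) ^ 2 - 1) * (ln (real m) - ln (ln (real m)) + K)"
    using assms by real_asymp
  ultimately show ?thesis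
  proof eventually_elim
    case (elim m)
    define L where "L = ln (real m)"
    \<comment> \<open>The power \<open>2 ^ k\<close> is the largest one not exceeding
      \<open>m / L ^ 2\<close>, and \<open>r\<close> takes the rest of the budget
      \<open>c * m / L\<close>.\<close>
    define k where "k = nat \<lfloor>log 2 (real m / L ^ 2)\<rfloor>"
    define r where "r = nat \<lfloor>c * real m / L - real m / L ^ 2\<rfloor>"
    have L: "L > 1" and m: "real m > 1"
      using elim by (auto simp: L_def)
    have mL: "real m / L ^ 2 \<ge> 2"
      using elim by (simp add: L_def)
    have log1: "log 2 (real m / L ^ 2) \<ge> 1"
      using mL by (subst le_log_iff) auto
    have k: "k \<ge> 1" "real k \<le> log 2 (real m / L ^ 2)" "log 2 (real m / L ^ 2) < real k + 1"
      using log1 unfolding k_def by linarith+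
    have pow_le: "2 ^ k \<le> real m / L ^ 2"
      using k(2) mL by (subst (asm) le_log_iff) (auto simp: powr_realpow)
    have pow_ge: "real m / L ^ 2 < 2 * 2 ^ k"
      using k(3) mL by (subst (asm) log_less_iff) (auto simp: powr_realpow powr_add)
    have r: "r \<ge> 1" "real r \<le> c * real m / L - real m / L ^ 2"
        "c * real m / L - real m / L ^ 2 - 1 < real r"
      using elim unfolding r_def L_def by linarith+
    have R: "2 ^ k + real r \<le> c * real m / L"
      using pow_le r(2) by linarith
    have r': "real r \<le> c * real m / L"
      using R by (smt (verit) zero_le_power)
    have "real m / L ^ 2 \<le> real m"
      using L m by (simp add: divide_le_eq)
    then have "log 2 (real m / L ^ 2) \<le> log 2 (real m)"
      using mL m by (subst log_le_cancel_iff) auto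
    then have kL: "real k \<le> L / ln 2"
      using k(2) by (simp add: log_def L_def)
    \<comment> \<open>These are the digits of all blocks together with the \<open>k\<close> forced
      zeros.\<close>
    have "real (k * (r + 1)) = real k * real r + real k"
      by (simp add: algebra_simps)
    also have "\<dots> \<le> (L / ln 2) * (c * real m / L) + L / ln 2"
      using kL r' L by (intro add_mono mult_mono) auto
    also have "\<dots> \<le> c * real m / ln 2 + \<delta> * real m"
      using elim L by (simp add: L_def)
    also have "\<dots> = real m - \<delta> * real m"
      by (simp add: \<delta>_def field_simps)
    finally have used: "real (k * (r + 1)) \<le> real m - \<delta> * real m" .
    then have "real (k * (r + 1)) \<le> real m"
      using \<open>\<delta> > 0\<close> by (smt (verit) mult_nonneg_nonneg of_nat_0_le_iff)
    then have le: "k * (r + 1) \<le> m"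
      by linarith
    define j where "j = m - k * (r + 1)"
    have mj: "m = k + j + k * r"
      using le by (simp add: j_def)
    have j: "\<delta> * real m \<le> real j"
      using used le by (simp add: j_def of_nat_diff)
    have "D * L * real r \<le> D * L * (c * real m / L)"
      using r' \<open>D > 0\<close> L by (intro mult_left_mono) auto
    also have "\<dots> = \<delta> * real m"
      using L assms by (simp add: D_def)
    finally have \<beta>: "D * L \<le> real j / real r"
      using j r(1) by (simp add: field_simps)
    \<comment> \<open>Of the factor 4, one 2 is lost by rounding \<open>k\<close> down and one by
      the blocks being odd.\<close>
    have "exp (real r * (ln (D * L) + ln (real m / L ^ 2 / 4)))
        \<le> real (chain_count m (c * real m / L))"
      using pow_ge mL L \<open>D > 0\<close> m by (intro chain_count_ge_exp[OF k(1) r(1) mj R \<beta>]) auto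
    also have "ln (D * L) + ln (real m / L ^ 2 / 4) = L - ln L + K"
      using L \<open>D > 0\<close> m by (simp add: ln_mult ln_div ln_realpow K_def L_def)
    finally have "exp (real r * (L - ln L + K)) \<le> real (chain_count m (c * real m / L))" .
    \<comment> \<open>Replacing \<open>r\<close> by its lower bound uses that
      \<open>L - ln L + K\<close> is positive for large \<open>m\<close>.\<close>
    moreover have "(c * real m / L - real m / L ^ 2 - 1) * (L - ln L + K) \<le> real r * (L - ln L + K)"
      using r(3) elim by (intro mult_right_mono) (auto simp: L_def)
    then have "exp (c * real m - c * (1 + \<epsilon>) * real m * ln (ln (real m)) / ln (real m))
        < exp (real r * (L - ln L + K))"
      using elim by (auto simp: L_def intro: less_le_trans)
    ultimately show ?case
      unfolding L_def by (rule order.strict_trans2[rotated])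
  qed
qed

end
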